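(* Let $n\ge 1$. For every domain $G\subsetneq\mathbb{R}^n$, the point pair function $p_G$ is a quasi-metric on $G$ with a constant less than or equal to $\sqrt{2}$; that is, $p_G$ satisfies positivity and symmetry, and there is a constant $c\le\sqrt{2}$ with $p_G(x,y)\leq c\,(p_G(x,z)+p_G(z,y))$ for all $x,y,z\in G$.
   Context: A domain is a non-empty open connected set. For a domain $G\subsetneq\mathbb{R}^n$ and $x\in G$, $d_G(x)=\inf\{|x-z| : z\in\partial G\}$. The point pair function is $p_G:G\times G\to[0,1]$, $$p_G(x,y)=\frac{|x-y|}{\sqrt{|x-y|^2+4d_G(x)d_G(y)}}.$$ Positivity of a function $d:G\times G\to[0,\infty)$ means $d(x,y)\ge 0$, with $d(x,y)=0$ if and only if $x=y$; symmetry means $d(x,y)=d(y,x)$. A quasi-metric with constant $c$ is a function satisfying positivity, symmetry, and the relaxed triangle inequality $d(x,y)\le c(d(x,z)+d(z,y))$ for all $x,y,z$, with $c$ independent of $x,y,z$. *)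

theory Defs
  imports "HOL-Analysis.Analysis"
begin

definition is_domain :: "(real ^ 'n) set \<Rightarrow> bool" where
  "is_domain G \<longleftrightarrow> open G \<and> connected G \<and> G \<noteq> {}"

(* infdist x {} = 0 by convention in the library; this case does not arise for a
   domain G \<noteq> UNIV, whose boundary is non-empty. *)
definition bdist :: "(real ^ 'n) set \<Rightarrow> real ^ 'n \<Rightarrow> real" where
  "bdist G x = infdist x (frontier G)"

definition point_pair :: "(real ^ 'n) set \<Rightarrow> real ^ 'n \<Rightarrow> real ^ 'n \<Rightarrow> real" where
  "point_pair G x y =
     norm (x - y) / sqrt ((norm (x - y))\<^sup>2 + 4 * bdist G x * bdist G y)"

definition quasi_metric_on :: "'a set \<Rightarrow> real \<Rightarrow> ('a \<Rightarrow> 'a \<Rightarrow> real) \<Rightarrow> bool" where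
  "quasi_metric_on G c d \<longleftrightarrow>
     (\<forall>x\<in>G. \<forall>y\<in>G. d x y \<ge> 0 \<and> (d x y = 0 \<longleftrightarrow> x = y)) \<and>
     (\<forall>x\<in>G. \<forall>y\<in>G. d x y = d y x) \<and>
     (\<forall>x\<in>G. \<forall>y\<in>G. \<forall>z\<in>G. d x y \<le> c * (d x z + d z y))"

end

theory Submission
  imports Defs
begin

text \<open>
  Compare the point pair function with \<open>j(x,y) = |x - y| / (|x - y| + 2 min (d(x), d(y)))\<close>.
  Since \<open>d\<close> is 1-Lipschitz, \<open>j \<le> p \<le> sqrt 2 * j\<close>, and \<open>j\<close> satisfies the triangle inequality,
  being \<open>tanh (\<delta>/2)\<close> for the distance ratio metric
  \<open>\<delta>(x,y) = ln (1 + |x - y| / min (d(x), d(y)))\<close>.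
\<close>

definition ratio_tanh :: "real \<Rightarrow> real \<Rightarrow> real \<Rightarrow> real" where
  "ratio_tanh t u v = t / (t + 2 * min u v)"

lemma ratio_tanh_commute: "ratio_tanh t u v = ratio_tanh t v u"
  by (simp add: ratio_tanh_def min.commute)

lemma divide_self_add_mono:
  fixes s t m k :: real
  assumes "0 \<le> s" "s \<le> t" "0 < k" "k \<le> m"
  shows "s / (s + m) \<le> t / (t + k)"
proof -
  have "s * k \<le> t * m"
    using assms by (intro mult_mono) auto
  then show ?thesis
    using assms by (simp add: divide_simps algebra_simps)
qed

text \<open>Here \<open>t\<close> plays |x - y| while \<open>u\<close>, \<open>v\<close> play the
  boundary distances, so the last hypothesis is the Lipschitz bound. With m, M the minimum and
  maximum of \<open>u\<close>, \<open>v\<close>, the difference of squared denominators is 4m(t + m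
  - M), nonnegative because M - m \<le> t.\<close>

lemma ratio_tanh_le:
  assumes "0 \<le> t" "0 < u" "0 < v" "\<bar>u - v\<bar> \<le> t"
  shows "ratio_tanh t u v \<le> t / sqrt (t\<^sup>2 + 4 * u * v)"
proof -
  have le: "t\<^sup>2 + 4 * u * v \<le> (t + 2 * min u v)\<^sup>2"
  proof (cases "u \<le> v")
    case True
    then have "u * v \<le> u * (u + t)"
      using assms by (intro mult_left_mono) auto
    with True show ?thesis
      by (simp add: min_def power2_eq_square algebra_simps)
  next
    case False
    then have "v * u \<le> v * (v + t)"
      using assms by (intro mult_left_mono) auto
    with False show ?thesis
      by (simp add: min_def power2_eq_square algebra_simps)
  qed
  have "0 < u * v"
    using assms by simp
  then have "0 < t\<^sup>2 + 4 * u * v"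
    by (simp add: add_nonneg_pos)
  moreover have "sqrt (t\<^sup>2 + 4 * u * v) \<le> t + 2 * min u v"
    using assms le by (intro real_le_lsqrt) auto
  ultimately show ?thesis
    unfolding ratio_tanh_def using assms by (intro divide_left_mono) auto
qed

text \<open>The source of the constant \<open>sqrt 2\<close>: (t + 2m)^2 \<le> 2(t^2 + 4m^2) for m =
  \<open>min u v\<close>, and m^2 \<le> uv.\<close>

lemma le_sqrt2_ratio_tanh:
  assumes "0 \<le> t" "0 < u" "0 < v"
  shows "t / sqrt (t\<^sup>2 + 4 * u * v) \<le> sqrt 2 * ratio_tanh t u v"
proof -
  define m where "m = min u v"
  have m: "0 < m" "m \<le> u" "m \<le> v"
    using assms by (auto simp: m_def)
  then have "m * m \<le> u * v"
    by (intro mult_mono) auto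
  moreover have "0 \<le> (t - 2 * m)\<^sup>2"
    by simp
  ultimately have "(t + 2 * m)\<^sup>2 \<le> 2 * (t\<^sup>2 + 4 * u * v)"
    by (simp add: power2_eq_square algebra_simps)
  then have "t + 2 * m \<le> sqrt 2 * sqrt (t\<^sup>2 + 4 * u * v)"
    by (simp add: real_le_rsqrt flip: real_sqrt_mult)
  then have "t * (t + 2 * m) \<le> t * (sqrt 2 * sqrt (t\<^sup>2 + 4 * u * v))"
    using assms by (intro mult_left_mono)
  moreover have "0 < t\<^sup>2 + 4 * u * v"
    using assms by (simp add: add_nonneg_pos)
  then have "0 < sqrt (t\<^sup>2 + 4 * u * v)"
    by simp
  moreover have "0 < t + 2 * m"
    using assms m by simp
  ultimately show ?thesis
    unfolding ratio_tanh_def m_def[symmetric]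
    by (simp add: pos_divide_le_eq pos_le_divide_eq mult_ac)
qed

text \<open>The ordering \<open>u \<le> v\<close> makes \<open>u\<close> the minimum on the left;
  the opposite order follows by exchanging the end points.\<close>

lemma ratio_tanh_triangle_le:
  assumes "0 \<le> a" "0 \<le> b" "0 \<le> t" "t \<le> a + b"
    and "0 < u" "u \<le> v" "0 < w" "\<bar>u - w\<bar> \<le> a"
  shows "ratio_tanh t u v \<le> ratio_tanh a u w + ratio_tanh b w v"
proof -
  \<comment> \<open>For fixed \<open>u\<close> the quotient increases with \<open>t\<close>, so
    \<open>t\<close> may be replaced by \<open>a + b\<close>.\<close>
  have "ratio_tanh t u v \<le> (a + b) / (a + b + 2 * u)"
    unfolding ratio_tanh_def using assms by (intro divide_self_add_mono) auto
  also have "\<dots> \<le> ratio_tanh a u w + ratio_tanh b w v"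
  proof (cases "w \<le> u")
    case True
    \<comment> \<open>Both minima on the right equal \<open>w\<close>, so each denominator there is
      at most \<open>a + b + 2 * u\<close>.\<close>
    have "a / (a + b + 2 * u) \<le> ratio_tanh a u w"
      unfolding ratio_tanh_def using assms True by (intro divide_left_mono) auto
    moreover have "b / (a + b + 2 * u) \<le> ratio_tanh b w v"
      unfolding ratio_tanh_def using assms True by (intro divide_left_mono) auto
    ultimately show ?thesis
      by (simp add: add_divide_distrib)
  next
    case False
    define s where "s = 2 * u"
    have s: "0 < s"
      using assms by (simp add: s_def)
    \<comment> \<open>Relative to the common denominator \<open>a + b + s\<close>, the first
      fraction gains and the second loses. Both changes carry the factor
      \<open>a * b / (a + b + s)\<close>, and the gain wins because
      \<open>a + s \<le> b + s + 2 * a\<close>.\<close>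
    have "a / (a + s) + b / (b + s + 2 * a) - (a + b) / (a + b + s)
        = a * b / (a + b + s) * (1 / (a + s) - 1 / (b + s + 2 * a))"
    proof -
      have "a + s \<noteq> 0" "b + s + 2 * a \<noteq> 0" "a + b + s \<noteq> 0"
        using s assms by linarith+
      then show ?thesis
        by (simp add: divide_simps) (simp add: algebra_simps)
    qed
    moreover have "1 / (b + s + 2 * a) \<le> 1 / (a + s)"
      using s assms by (intro divide_left_mono) auto
    then have "0 \<le> a * b / (a + b + s) * (1 / (a + s) - 1 / (b + s + 2 * a))"
      using s assms by (intro mult_nonneg_nonneg) auto
    ultimately have "(a + b) / (a + b + s) \<le> a / (a + s) + b / (b + s + 2 * a)"
      by linarith
    moreover have "ratio_tanh a u w = a / (a + s)"
      using False by (simp add: ratio_tanh_def s_def)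
    \<comment> \<open>The Lipschitz hypothesis gives \<open>min w v \<le> w \<le> u + a\<close>,
      whence the term \<open>2 * a\<close>.\<close>
    moreover have "b / (b + s + 2 * a) \<le> ratio_tanh b w v"
      unfolding ratio_tanh_def s_def using assms False by (intro divide_left_mono) auto
    ultimately show ?thesis
      by (simp add: s_def)
  qed
  finally show ?thesis .
qed

lemma ratio_tanh_triangle:
  assumes "0 \<le> a" "0 \<le> b" "0 \<le> t" "t \<le> a + b"
    and "0 < u" "0 < v" "0 < w" "\<bar>u - w\<bar> \<le> a" "\<bar>w - v\<bar> \<le> b"
  shows "ratio_tanh t u v \<le> ratio_tanh a u w + ratio_tanh b w v"
proof (cases "u \<le> v")
  case True
  then show ?thesis
    using assms by (intro ratio_tanh_triangle_le) auto
next
  case False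
  then have "ratio_tanh t v u \<le> ratio_tanh b v w + ratio_tanh a w u"
    using assms by (intro ratio_tanh_triangle_le) auto
  then show ?thesis
    by (simp add: ratio_tanh_commute[of _ v] ratio_tanh_commute[of _ w u])
qed

lemma bdist_pos:
  assumes "is_domain G" "G \<noteq> UNIV" "x \<in> G"
  shows "0 < bdist G x"
proof -
  \<comment> \<open>Only the empty set and the whole space have empty frontier. This excludes the
    default value 0 of \<open>infdist\<close> at the empty set.\<close>
  have "frontier G \<noteq> {}"
    using assms by (auto simp: is_domain_def frontier_eq_empty)
  moreover have "x \<notin> frontier G"
    using assms by (auto simp: is_domain_def frontier_def interior_open)
  ultimately show ?thesis
    unfolding bdist_def by (simp add: infdist_pos_not_in_closed)
qed

lemma abs_bdist_diff_le: "\<bar>bdist G x - bdist G y\<bar> \<le> norm (x - y)"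
  unfolding bdist_def dist_norm[symmetric] by (rule infdist_triangle_abs)

theorem lemma3p1:
  fixes G :: "(real ^ 'n) set"
  assumes "is_domain G" and "G \<noteq> UNIV"
  shows "\<exists>c. c \<le> sqrt 2 \<and> quasi_metric_on G c (point_pair G)"
proof (intro exI conjI)
  define d where "d = bdist G"
  have pos: "0 < d x" if "x \<in> G" for x
    unfolding d_def using assms that by (rule bdist_pos)
  have lip: "\<bar>d x - d y\<bar> \<le> norm (x - y)" for x y
    unfolding d_def by (rule abs_bdist_diff_le)
  define j where "j x y = ratio_tanh (norm (x - y)) (d x) (d y)" for x y
  have lower: "j x y \<le> point_pair G x y" if "x \<in> G" "y \<in> G" for x y
    unfolding j_def point_pair_def d_def[symmetric]
    using pos that lip by (intro ratio_tanh_le) auto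
  have upper: "point_pair G x y \<le> sqrt 2 * j x y" if "x \<in> G" "y \<in> G" for x y
    unfolding j_def point_pair_def d_def[symmetric]
    using pos that by (intro le_sqrt2_ratio_tanh) auto
  have triangle: "j x y \<le> j x z + j z y" if "x \<in> G" "y \<in> G" "z \<in> G" for x y z
    unfolding j_def using pos that lip norm_triangle_ineq[of "x - z" "z - y"]
    by (intro ratio_tanh_triangle) auto
  \<comment> \<open>A zero denominator would make the quotient 0 by convention; with a positive one
    it vanishes only with its numerator.\<close>
  have radicand: "0 < (norm (x - y))\<^sup>2 + 4 * d x * d y" if "x \<in> G" "y \<in> G" for x y
    using pos that by (simp add: add_nonneg_pos)
  \<comment> \<open>This fixes the constant left schematic at the start; what remains is
    \<open>sqrt 2 \<le> sqrt 2\<close>.\<close>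
  show "quasi_metric_on G (sqrt 2) (point_pair G)"
    unfolding quasi_metric_on_def
  proof (intro conjI ballI)
    fix x y assume xy: "x \<in> G" "y \<in> G"
    show "0 \<le> point_pair G x y" "point_pair G x y = 0 \<longleftrightarrow> x = y"
      using radicand[OF xy] by (auto simp: point_pair_def d_def)
    show "point_pair G x y = point_pair G y x"
      by (simp add: point_pair_def norm_minus_commute mult_ac)
    fix z assume z: "z \<in> G"
    \<comment> \<open>The comparison of \<open>j\<close> with \<open>point_pair\<close> from below
      has constant 1, so the factor \<open>sqrt 2\<close> enters only once, through
      \<open>upper\<close>.\<close>
    have "j x y \<le> point_pair G x z + point_pair G z y"
      using triangle[OF xy z] lower[OF xy(1) z] lower[OF z xy(2)] by linarith
    then have "sqrt 2 * j x y \<le> sqrt 2 * (point_pair G x z + point_pair G z y)"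
      by (intro mult_left_mono) auto
    with upper[OF xy] show "point_pair G x y \<le> sqrt 2 * (point_pair G x z + point_pair G z y)"
      by linarith
  qed
qed simp

end
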